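(* Let $n\geq 2$ be an integer. The eigenvalues $\lambda_1^{(n)}\geq \lambda_2^{(n)}\geq \cdots\geq \lambda_n^{(n)}>0$ of $Z_n$ (counted with multiplicity) satisfy $\lambda_2^{(n)}<\frac45$ and $\lambda_1^{(n)}>1$.
   Context: Let $(F_k)_{k\ge 1}$ be the Fibonacci numbers, $F_1=F_2=1$ and $F_k=F_{k-1}+F_{k-2}$ for $k\geq 3$. For each positive integer $n$, $Z_n$ is the real symmetric (positive definite) $n\times n$ matrix defined elementwise, for $i,j\in\{1,\ldots,n\}$, by $$ (Z_n)_{i,j}=\begin{cases} 1+\sum_{k=i+1}^nF_{k-i}^2&\text{if }i=j,\\ (-1)^{j-i}\big(F_{j-i}+\sum_{k=j+1}^nF_{k-i}F_{k-j}\big)&\text{if }i<j,\\ (-1)^{i-j}\big(F_{i-j}+\sum_{k=i+1}^nF_{k-i}F_{k-j}\big)&\text{if }i>j, \end{cases} $$ where empty sums are $0$. *)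

theory Defs
  imports
    "Jordan_Normal_Form.Char_Poly"
    "HOL-Number_Theory.Fib"
begin

text \<open>
  The entry formula uses the mathematical indices \<open>1, ..., n\<close>; the matrix library counts rows
  and columns from \<open>0\<close>, hence the shift by \<^const>\<open>Suc\<close> in \<open>Z_mat\<close>.
\<close>

definition Z_entry :: "nat \<Rightarrow> nat \<Rightarrow> nat \<Rightarrow> real" where
  "Z_entry n i j =
    (if i = j then 1 + (\<Sum>k = i + 1..n. (real (fib (k - i)))\<^sup>2)
     else if i < j then
       (-1) ^ (j - i) *
         (real (fib (j - i)) + (\<Sum>k = j + 1..n. real (fib (k - i)) * real (fib (k - j))))
     else
       (-1) ^ (i - j) *
         (real (fib (i - j)) + (\<Sum>k = i + 1..n. real (fib (k - i)) * real (fib (k - j)))))"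

definition Z_mat :: "nat \<Rightarrow> real mat" where
  "Z_mat n = mat n n (\<lambda>(i, j). Z_entry n (Suc i) (Suc j))"

text \<open>
  The real eigenvalues of a square matrix, in non-increasing order and repeated according to their
  multiplicity as roots of the characteristic polynomial. The list has as many entries as the
  matrix has rows exactly if the characteristic polynomial splits over the reals. Entry \<open>k\<close> of the
  list is the \<open>(k + 1)\<close>-st largest eigenvalue.
\<close>

definition eigenvalues_desc :: "real mat \<Rightarrow> real list" where
  "eigenvalues_desc A = rev (sorted_list_of_multiset (proots (char_poly A)))"

end

theory Submission
  imports Defs "Jordan_Normal_Form.Schur_Decomposition"
begin

text \<open>
  Let \<open>K\<close> be the strictly upper triangular matrix with entries \<open>- (- 1) ^ d * fib d\<close> on the
  \<open>d\<close>-th superdiagonal. The entry formula says precisely that the matrix \<open>Z\<close> in question is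
  \<open>(I - K) (I - K)\<^sup>T\<close>, so with \<open>u = K\<^sup>T x\<close> its quadratic form is the sum of the squares
  \<open>(x\<^sub>k - u\<^sub>k)\<^sup>2\<close> (\<open>Z_mat_form\<close>). The Fibonacci recurrence turns into
  \<open>x\<^sub>k = u\<^sub>k\<^sub>+\<^sub>1 + u\<^sub>k - u\<^sub>k\<^sub>-\<^sub>1\<close>, hence \<open>x\<^sub>k - u\<^sub>k = u\<^sub>k\<^sub>+\<^sub>1 - u\<^sub>k\<^sub>-\<^sub>1\<close>: the form and the squared norm of \<open>x\<close>
  become sums of squares of short linear recurrences in \<open>u\<close>.

  On bi-infinite sequences these two filters have symbols \<open>1 - z\<^sup>2\<close> and \<open>1 + z - z\<^sup>2\<close>, and for
  \<open>z = exp (i t)\<close> the quotient of their squared absolute values is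
  \<open>4 sin\<^sup>2 t / (1 + 4 sin\<^sup>2 t) \<le> 4/5\<close>. This is where the constant comes from. The nonnegative
  difference \<open>4/5 (1 + 4 sin\<^sup>2 t) - 4 sin\<^sup>2 t = 4/5 cos\<^sup>2 t\<close> is the symbol of the sum of the squares
  \<open>1/5 (u\<^sub>k\<^sub>+\<^sub>1 + u\<^sub>k\<^sub>-\<^sub>1)\<^sup>2\<close>. For finite sequences the comparison is perturbed only by a boundary
  form in \<open>u\<^sub>n\<close> and \<open>u\<^sub>n\<^sub>-\<^sub>1\<close> (\<open>fib_conv_square_identity\<close>), and this boundary form is nonnegative as
  soon as \<open>u\<^sub>n = 0\<close>. So \<open>x \<bullet> Z x < 4/5 (x \<bullet> x)\<close> for all nonzero \<open>x\<close> in the hyperplane \<open>u\<^sub>n = 0\<close>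
  (\<open>Z_mat_form_less\<close>).

  A symmetric matrix whose form is below \<open>\<mu>\<close> times the squared norm on a hyperplane has second
  largest eigenvalue below \<open>\<mu>\<close> (\<open>second_eigenvalue_less\<close>, one half of the Courant-Fischer principle):
  the plane spanned by two orthogonal eigenvectors for the two largest eigenvalues meets the
  hyperplane. Such eigenvectors are obtained also for a multiple root of the characteristic polynomial,
  from the first two columns of a Schur decomposition. All eigenvalues are positive because the form
  is, and the largest one exceeds \<open>1\<close> because the trace exceeds \<open>n\<close>.
\<close>

section \<open>Real symmetric matrices\<close>

lemma map_poly_prod_list_linear:
  "map_poly complex_of_real (\<Prod>a\<leftarrow>as. [:- a, 1:]) = (\<Prod>a\<leftarrow>as. [:- complex_of_real a, 1:])"
proof -
  interpret map_poly_comm_ring_hom complex_of_real ..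
  show ?thesis by (induction as) (simp_all add: hom_distribs)
qed

text \<open>
  For an eigenvector \<open>v\<close>, moving the matrix from one factor of the Hermitian product of \<open>v\<close> with
  itself to the other replaces the eigenvalue by its conjugate.
\<close>

lemma symmetric_complex_eigenvalue_real:
  fixes A :: "real mat"
  assumes A: "A \<in> carrier_mat n n" and sym: "transpose_mat A = A"
    and ev: "eigenvalue (map_mat complex_of_real A) a"
  shows "Im a = 0"
proof -
  define C where "C = map_mat complex_of_real A"
  have C: "C \<in> carrier_mat n n" using A by (simp add: C_def)
  have symC: "transpose_mat C = C"
    unfolding C_def by (metis map_mat_transpose sym)
  obtain v where v: "v \<in> carrier_vec n" "v \<noteq> 0\<^sub>v n" "C *\<^sub>v v = a \<cdot>\<^sub>v v"
    using ev C unfolding eigenvalue_def eigenvector_def C_def by auto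
  have cv: "conjugate v \<in> carrier_vec n" using v by simp
  have conj_C: "C *\<^sub>v conjugate v = conjugate (C *\<^sub>v v)"
    by (rule eq_vecI) (use A v(1) in \<open>auto simp: C_def scalar_prod_def conjugate_complex_def\<close>)
  have "a * (v \<bullet> conjugate v) = (C *\<^sub>v v) \<bullet> conjugate v"
    using v cv by simp
  also have "\<dots> = v \<bullet> (C *\<^sub>v conjugate v)"
    using transpose_vec_mult_scalar[OF C cv v(1)] symC by simp
  also have "\<dots> = cnj a * (v \<bullet> conjugate v)"
    unfolding conj_C v(3) using v by (simp add: conjugate_smult_vec conjugate_complex_def)
  finally have "a = cnj a"
    using conjugate_square_eq_0_vec[OF v(1)] v(2) by auto
  thus ?thesis by (metis Reals_cnj_iff complex_is_Real_iff)
qed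

text \<open>
  Over the complex numbers the characteristic polynomial splits; its roots are real, and the
  factorization descends because the embedding of real into complex polynomials is injective.
\<close>

lemma symmetric_char_poly_splits:
  fixes A :: "real mat"
  assumes A: "A \<in> carrier_mat n n" and sym: "transpose_mat A = A"
  shows "\<exists>as. char_poly A = (\<Prod>a\<leftarrow>as. [:- a, 1:]) \<and> length as = n"
proof -
  interpret inj_comm_ring_hom complex_of_real by unfold_locales auto
  interpret P: map_poly_inj_comm_ring_hom complex_of_real ..
  define C where "C = map_mat complex_of_real A"
  have C: "C \<in> carrier_mat n n" using A by (simp add: C_def)
  obtain as where as: "char_poly C = (\<Prod>a\<leftarrow>as. [:- a, 1:])" "length as = n"
    using char_poly_factorized[OF C] by auto
  have "complex_of_real (Re a) = a" if "a \<in> set as" for a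
  proof -
    have "poly (char_poly C) a = 0"
      unfolding as(1) using linear_poly_root[OF that] by simp
    hence "Im a = 0"
      using symmetric_complex_eigenvalue_real[OF A sym] eigenvalue_root_char_poly[OF C]
      by (simp add: C_def)
    thus ?thesis by (simp add: complex_eq_iff)
  qed
  hence re: "map (complex_of_real \<circ> Re) as = as" by (simp add: map_idI)
  have "map_poly complex_of_real (char_poly A) = char_poly C"
    unfolding C_def of_real_hom.char_poly_hom[OF A] ..
  also have "\<dots> = (\<Prod>a\<leftarrow>map Re as. [:- complex_of_real a, 1:])"
    by (subst as(1), subst (1) re[symmetric]) (simp add: comp_def)
  also have "\<dots> = map_poly complex_of_real (\<Prod>a\<leftarrow>map Re as. [:- a, 1:])"
    by (rule map_poly_prod_list_linear[symmetric])
  finally have "char_poly A = (\<Prod>a\<leftarrow>map Re as. [:- a, 1:])"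
    by (rule P.injectivity)
  thus ?thesis using as(2) by (intro exI[of _ "map Re as"]) simp
qed

lemma proots_prod_list_linear:
  fixes as :: "real list"
  shows "proots (\<Prod>a\<leftarrow>as. [:- a, 1:]) = mset as"
proof (induction as)
  case (Cons a as)
  have "(\<Prod>a\<leftarrow>as. [:- a, 1:]) \<noteq> 0" by (auto simp: prod_list_zero_iff)
  thus ?case using Cons by (simp add: proots_mult del: mult_pCons_left)
qed simp

lemma symmetric_eigenvalues_desc:
  fixes A :: "real mat"
  assumes A: "A \<in> carrier_mat n n" and sym: "transpose_mat A = A"
  shows "length (eigenvalues_desc A) = n"
    and "char_poly A = (\<Prod>a\<leftarrow>eigenvalues_desc A. [:- a, 1:])"
    and "sorted (rev (eigenvalues_desc A))"
proof -
  obtain as where as: "char_poly A = (\<Prod>a\<leftarrow>as. [:- a, 1:])" "length as = n"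
    using symmetric_char_poly_splits[OF A sym] by auto
  have m: "mset (eigenvalues_desc A) = mset as"
    unfolding eigenvalues_desc_def as(1) by (simp add: proots_prod_list_linear)
  thus "length (eigenvalues_desc A) = n" using as(2) by (metis size_mset)
  show "char_poly A = (\<Prod>a\<leftarrow>eigenvalues_desc A. [:- a, 1:])"
    unfolding as(1) prod_mset_prod_list[symmetric] mset_map m ..
  show "sorted (rev (eigenvalues_desc A))"
    by (simp add: eigenvalues_desc_def)
qed

lemma trace_mult_commute:
  fixes X Y :: "'a :: comm_semiring_0 mat"
  assumes "X \<in> carrier_mat n m" "Y \<in> carrier_mat m n"
  shows "(\<Sum>i<n. (X * Y) $$ (i, i)) = (\<Sum>i<m. (Y * X) $$ (i, i))"
proof -
  have "(\<Sum>i<n. (X * Y) $$ (i, i)) = (\<Sum>i<n. \<Sum>j<m. X $$ (i, j) * Y $$ (j, i))"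
    using assms by (intro sum.cong) (auto simp: scalar_prod_def atLeast0LessThan)
  also have "\<dots> = (\<Sum>j<m. \<Sum>i<n. X $$ (i, j) * Y $$ (j, i))" by (rule sum.swap)
  also have "\<dots> = (\<Sum>j<m. (Y * X) $$ (j, j))"
    using assms by (intro sum.cong) (auto simp: scalar_prod_def atLeast0LessThan mult.commute)
  finally show ?thesis .
qed

text \<open>
  The trace is invariant under similarity, and a triangular matrix similar to \<open>A\<close> carries the
  roots of the characteristic polynomial on its diagonal.
\<close>

lemma trace_eq_sum_list_eigenvalues:
  fixes A :: "real mat"
  assumes A: "A \<in> carrier_mat n n" and cp: "char_poly A = (\<Prod>a\<leftarrow>es. [:- a, 1:])"
  shows "(\<Sum>i<n. A $$ (i, i)) = sum_list es"
proof -
  obtain B P Q where BPQ: "schur_decomposition A es = (B, P, Q)"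
    by (rule prod_cases3)
  from schur_decomposition[OF A cp BPQ]
  have sim: "similar_mat_wit A B P Q" and diag: "diag_mat B = es" by auto
  note s = similar_mat_witD2[OF A sim]
  have "(\<Sum>i<n. A $$ (i, i)) = (\<Sum>i<n. (P * (B * Q)) $$ (i, i))"
    using s by (simp add: assoc_mult_mat[of P n n B n Q n])
  also have "\<dots> = (\<Sum>i<n. (B * Q * P) $$ (i, i))"
    by (rule trace_mult_commute) (use s in auto)
  also have "B * Q * P = B" using s by (simp add: assoc_mult_mat[of B n n Q n P n])
  also have "(\<Sum>i<n. B $$ (i, i)) = sum_list es"
    using s unfolding diag[symmetric] diag_mat_def
    by (simp add: sum_list_sum_nth atLeast0LessThan)
  finally show ?thesis .
qed

text \<open>
  The first two columns of the transformation matrix of a Schur decomposition in which the chosen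
  two roots come first. Here \<open>\<alpha> = \<beta>\<close> is allowed: the second vector exists by algebraic multiplicity
  alone, at the price of the coefficient \<open>b\<close>.
\<close>

lemma two_dim_invariant_subspace:
  fixes A :: "real mat"
  assumes A: "A \<in> carrier_mat n n" and n: "n \<ge> 2"
    and cp: "char_poly A = (\<Prod>a\<leftarrow>\<alpha> # \<beta> # es. [:- a, 1:])"
  obtains v p b where "v \<in> carrier_vec n" "p \<in> carrier_vec n" "v \<noteq> 0\<^sub>v n"
    "\<And>c. p \<noteq> c \<cdot>\<^sub>v v" "A *\<^sub>v v = \<alpha> \<cdot>\<^sub>v v" "A *\<^sub>v p = b \<cdot>\<^sub>v v + \<beta> \<cdot>\<^sub>v p"
proof -
  obtain B P Q where BPQ: "schur_decomposition A (\<alpha> # \<beta> # es) = (B, P, Q)"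
    by (rule prod_cases3)
  from schur_decomposition[OF A cp BPQ]
  have sim: "similar_mat_wit A B P Q" and ut: "upper_triangular B"
    and diag: "diag_mat B = \<alpha> # \<beta> # es" by auto
  note s = similar_mat_witD2[OF A sim]
  have AP: "A * P = P * B"
  proof -
    have "A * P = P * B * Q * P" by (rule arg_cong[OF s(3)])
    also have "\<dots> = P * B * (Q * P)" by (rule assoc_mult_mat) (use s(5-7) in auto)
    finally show ?thesis using s(2,5,6) by simp
  qed
  have B00: "B $$ (0, 0) = \<alpha>" and B11: "B $$ (1, 1) = \<beta>"
  proof -
    have "diag_mat B ! i = B $$ (i, i)" if "i < n" for i
      using that s(5) by (simp add: diag_mat_def)
    from this[of 0] this[of 1] show "B $$ (0, 0) = \<alpha>" "B $$ (1, 1) = \<beta>"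
      using n by (simp_all add: diag)
  qed
  have low: "B $$ (k, j) = 0" if "j < k" "k < n" for j k
    using ut s(5) that by (auto dest: upper_triangularD)
  define v p where "v = col P 0" and "p = col P 1"
  have v: "v \<in> carrier_vec n" and p: "p \<in> carrier_vec n" using s(6) n by (auto simp: v_def p_def)
  have Pcol: "A *\<^sub>v col P j = P *\<^sub>v col B j" if "j < n" for j
    using col_mult2[OF A s(6) that] col_mult2[OF s(6,5) that] AP by simp
  have Av: "A *\<^sub>v v = \<alpha> \<cdot>\<^sub>v v"
  proof -
    have "P *\<^sub>v col B 0 = \<alpha> \<cdot>\<^sub>v v"
    proof (rule eq_vecI)
      fix i assume i: "i < dim_vec (\<alpha> \<cdot>\<^sub>v v)"
      hence "i < n" using v by simp
      hence "(P *\<^sub>v col B 0) $ i = (\<Sum>k<n. P $$ (i, k) * B $$ (k, 0))"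
        using s(5,6) n by (auto simp: scalar_prod_def atLeast0LessThan)
      also have "\<dots> = (\<Sum>k\<in>{0}. P $$ (i, k) * B $$ (k, 0))"
        using low n by (intro sum.mono_neutral_right) auto
      finally show "(P *\<^sub>v col B 0) $ i = (\<alpha> \<cdot>\<^sub>v v) $ i"
        using \<open>i < n\<close> s(6) n B00 by (simp add: v_def)
    qed (use s(6) v in auto)
    thus ?thesis using Pcol[of 0] n by (simp add: v_def)
  qed
  define b where "b = B $$ (0, 1)"
  have Ap: "A *\<^sub>v p = b \<cdot>\<^sub>v v + \<beta> \<cdot>\<^sub>v p"
  proof -
    have "P *\<^sub>v col B 1 = b \<cdot>\<^sub>v v + \<beta> \<cdot>\<^sub>v p"
    proof (rule eq_vecI)
      fix i assume i: "i < dim_vec (b \<cdot>\<^sub>v v + \<beta> \<cdot>\<^sub>v p)"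
      hence "i < n" using p by simp
      hence "(P *\<^sub>v col B 1) $ i = (\<Sum>k<n. P $$ (i, k) * B $$ (k, 1))"
        using s(5,6) n by (auto simp: scalar_prod_def atLeast0LessThan)
      also have "\<dots> = (\<Sum>k\<in>{0, 1}. P $$ (i, k) * B $$ (k, 1))"
        using low n by (intro sum.mono_neutral_right) auto
      finally show "(P *\<^sub>v col B 1) $ i = (b \<cdot>\<^sub>v v + \<beta> \<cdot>\<^sub>v p) $ i"
        using \<open>i < n\<close> s(6) n B11 by (simp add: v_def p_def b_def)
    qed (use s(6) v p in auto)
    thus ?thesis using Pcol[of 1] n by (simp add: p_def)
  qed
  have QP: "Q *\<^sub>v col P j = unit_vec n j" if "j < n" for j
    using col_mult2[OF s(7,6) that] s(2) that by simp
  have v0: "v \<noteq> 0\<^sub>v n"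
  proof
    assume "v = 0\<^sub>v n"
    hence zero: "unit_vec n 0 = Q *\<^sub>v 0\<^sub>v n"
      using QP[of 0] n by (simp add: v_def)
    have "row Q 0 \<in> carrier_vec n" using s(7) n by auto
    with arg_cong[OF zero, of "\<lambda>x. x $ 0"] show False using s(7) n by simp
  qed
  have indep: "p \<noteq> c \<cdot>\<^sub>v v" for c
  proof
    assume "p = c \<cdot>\<^sub>v v"
    hence "Q *\<^sub>v p = c \<cdot>\<^sub>v (Q *\<^sub>v v)" using mult_mat_vec[OF s(7) v] by simp
    hence "unit_vec n 1 = c \<cdot>\<^sub>v (unit_vec n 0 :: real vec)"
      using QP[of 0] QP[of 1] n by (simp add: v_def p_def)
    from arg_cong[OF this, of "\<lambda>x. x $ 1"] show False using n by simp
  qed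
  from that[OF v p v0 indep Av Ap] show ?thesis .
qed

text \<open>
  For a symmetric matrix, orthogonalizing the basis of the invariant plane makes the restriction of
  \<open>A\<close> to it both triangular and symmetric, hence diagonal.
\<close>

lemma symmetric_orthogonal_eigenvectors:
  fixes A :: "real mat"
  assumes A: "A \<in> carrier_mat n n" and sym: "transpose_mat A = A" and n: "n \<ge> 2"
    and cp: "char_poly A = (\<Prod>a\<leftarrow>\<alpha> # \<beta> # es. [:- a, 1:])"
  obtains v w where "v \<in> carrier_vec n" "w \<in> carrier_vec n" "v \<noteq> 0\<^sub>v n" "w \<noteq> 0\<^sub>v n"
    "A *\<^sub>v v = \<alpha> \<cdot>\<^sub>v v" "A *\<^sub>v w = \<beta> \<cdot>\<^sub>v w" "v \<bullet> w = 0"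
proof -
  obtain v p b where v: "v \<in> carrier_vec n" and p: "p \<in> carrier_vec n" and v0: "v \<noteq> 0\<^sub>v n"
    and indep: "\<And>c. p \<noteq> c \<cdot>\<^sub>v v" and Av: "A *\<^sub>v v = \<alpha> \<cdot>\<^sub>v v"
    and Ap: "A *\<^sub>v p = b \<cdot>\<^sub>v v + \<beta> \<cdot>\<^sub>v p"
    using two_dim_invariant_subspace[OF A n cp] by metis
  have vv: "v \<bullet> v \<noteq> 0" using v0 conjugate_square_eq_0_vec[OF v] by simp
  \<comment> \<open>One Gram-Schmidt step; it changes only the multiple of \<open>v\<close> in the image of the second vector.\<close>
  define c where "c = (v \<bullet> p) / (v \<bullet> v)"
  define w where "w = p - c \<cdot>\<^sub>v v"
  have w: "w \<in> carrier_vec n" using v p by (simp add: w_def)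
  have vw: "v \<bullet> w = 0" using v p vv by (simp add: w_def scalar_prod_minus_distrib[of _ n] c_def)
  have w0: "w \<noteq> 0\<^sub>v n"
  proof
    assume "w = 0\<^sub>v n"
    hence "(p - c \<cdot>\<^sub>v v) $ i = 0" if "i < n" for i using that by (simp add: w_def)
    hence "p = c \<cdot>\<^sub>v v" using v p by (intro eq_vecI) auto
    thus False using indep by simp
  qed
  define d where "d = b + c * \<beta> - c * \<alpha>"
  have Aw: "A *\<^sub>v w = d \<cdot>\<^sub>v v + \<beta> \<cdot>\<^sub>v w"
  proof -
    have "A *\<^sub>v w = A *\<^sub>v p - c \<cdot>\<^sub>v (A *\<^sub>v v)"
      unfolding w_def using A v p by (simp add: mult_minus_distrib_mat_vec mult_mat_vec)
    also have "\<dots> = d \<cdot>\<^sub>v v + \<beta> \<cdot>\<^sub>v w"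
      unfolding Ap Av w_def d_def using v p by (intro eq_vecI) (auto simp: algebra_simps)
    finally show ?thesis .
  qed
  \<comment> \<open>Symmetry forces the off-diagonal coefficient \<open>d\<close> to vanish.\<close>
  have "d * (v \<bullet> v) = v \<bullet> (A *\<^sub>v w)"
    unfolding Aw using v w vw by (simp add: scalar_prod_add_distrib[of _ n])
  also have "\<dots> = (A *\<^sub>v v) \<bullet> w" using transpose_vec_mult_scalar[OF A w v] sym by simp
  also have "\<dots> = 0" unfolding Av using v w vw by simp
  finally have "d = 0" using vv by simp
  hence "A *\<^sub>v w = \<beta> \<cdot>\<^sub>v w" using Aw v w by (intro eq_vecI) auto
  from that[OF v w v0 w0 Av this vw] show ?thesis .
qed

text \<open>
  The plane spanned by orthogonal eigenvectors for the two largest eigenvalues contains a nonzero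
  vector orthogonal to \<open>c\<close>. On that plane the form is at least the second eigenvalue times the
  squared norm, while on the hyperplane it is less than \<open>\<mu>\<close> times the squared norm.
\<close>

lemma second_eigenvalue_less:
  fixes A :: "real mat"
  assumes A: "A \<in> carrier_mat n n" and sym: "transpose_mat A = A" and n: "n \<ge> 2"
    and c: "c \<in> carrier_vec n"
    and form: "\<And>x. x \<in> carrier_vec n \<Longrightarrow> x \<noteq> 0\<^sub>v n \<Longrightarrow> c \<bullet> x = 0 \<Longrightarrow> x \<bullet> (A *\<^sub>v x) < \<mu> * (x \<bullet> x)"
  shows "eigenvalues_desc A ! 1 < \<mu>"
proof -
  note E = symmetric_eigenvalues_desc[OF A sym]
  obtain \<alpha> \<beta> es where es: "eigenvalues_desc A = \<alpha> # \<beta> # es"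
    using E(1) n by (metis One_nat_def Suc_1 Suc_le_length_iff)
  have le: "\<beta> \<le> \<alpha>" using E(3) by (simp add: es sorted_append)
  obtain v w where v: "v \<in> carrier_vec n" and w: "w \<in> carrier_vec n" 
    and v0: "v \<noteq> 0\<^sub>v n" and w0: "w \<noteq> 0\<^sub>v n"
    and Av: "A *\<^sub>v v = \<alpha> \<cdot>\<^sub>v v" and Aw: "A *\<^sub>v w = \<beta> \<cdot>\<^sub>v w" and vw: "v \<bullet> w = 0"
    using symmetric_orthogonal_eigenvectors[OF A sym n E(2)[unfolded es]] by metis
  have vv: "v \<bullet> v > 0" and ww: "w \<bullet> w > 0"
    using conjugate_square_greater_0_vec[OF v] conjugate_square_greater_0_vec[OF w] v0 w0 by auto
  have wv: "w \<bullet> v = 0" using vw v w comm_scalar_prod by metis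
  \<comment> \<open>A nontrivial combination of \<open>v\<close> and \<open>w\<close> in the hyperplane.\<close>
  obtain s t where st: "s \<noteq> 0 \<or> t \<noteq> 0" and orth: "s * (c \<bullet> v) + t * (c \<bullet> w) = 0"
  proof (cases "c \<bullet> v = 0")
    case True
    thus ?thesis using that[of 1 0] by simp
  next
    case False
    thus ?thesis using that[of "- (c \<bullet> w)" "c \<bullet> v"] by simp
  qed
  define x where "x = s \<cdot>\<^sub>v v + t \<cdot>\<^sub>v w"
  have x: "x \<in> carrier_vec n" using v w by (simp add: x_def)
  have cx: "c \<bullet> x = 0"
    using orth c v w by (simp add: x_def scalar_prod_add_distrib[of _ n])
  have xx: "x \<bullet> x = s\<^sup>2 * (v \<bullet> v) + t\<^sup>2 * (w \<bullet> w)"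
    using v w vw wv
    by (simp add: x_def scalar_prod_add_distrib[of _ n] add_scalar_prod_distrib[of _ n] power2_eq_square)
  have Ax: "A *\<^sub>v x = (s * \<alpha>) \<cdot>\<^sub>v v + (t * \<beta>) \<cdot>\<^sub>v w"
    using A v w Av Aw
    by (simp add: x_def mult_add_distrib_mat_vec[of _ n n] mult_mat_vec smult_smult_assoc)
  have xAx: "x \<bullet> (A *\<^sub>v x) = \<alpha> * (s\<^sup>2 * (v \<bullet> v)) + \<beta> * (t\<^sup>2 * (w \<bullet> w))"
    using v w vw wv unfolding Ax
    by (simp add: x_def scalar_prod_add_distrib[of _ n] add_scalar_prod_distrib[of _ n] power2_eq_square)
  have pos: "x \<bullet> x > 0"
    unfolding xx using st vv ww by (auto intro: add_pos_nonneg add_nonneg_pos)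
  hence "x \<noteq> 0\<^sub>v n" by auto
  have "\<beta> * (x \<bullet> x) \<le> x \<bullet> (A *\<^sub>v x)"
    unfolding xx xAx using le vv by (simp add: distrib_left mult_right_mono)
  also have "\<dots> < \<mu> * (x \<bullet> x)" by (rule form[OF x \<open>x \<noteq> 0\<^sub>v n\<close> cx])
  finally show ?thesis using pos by (simp add: es)
qed

section \<open>The quadratic form of the Fibonacci matrix\<close>

text \<open>
  The entries of the strictly upper triangular matrix \<open>K\<close> with \<open>Z = (I - K) (I - K)\<^sup>T\<close>. The leading
  minus sign makes the first superdiagonal \<open>1\<close>.
\<close>

definition fib_coeff :: "nat \<Rightarrow> nat \<Rightarrow> real" where
  "fib_coeff i k = (if i < k then - ((- 1) ^ (k - i) * real (fib (k - i))) else 0)"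

text \<open>The sequence \<open>K\<^sup>T x\<close>; its value at \<open>k\<close> involves only the earlier terms of \<open>x\<close>.\<close>

definition fib_conv :: "(nat \<Rightarrow> real) \<Rightarrow> nat \<Rightarrow> real" where
  "fib_conv x k = (\<Sum>i<k. fib_coeff i k * x i)"

lemma fib_coeff_rec:
  assumes "i < k"
  shows "fib_coeff i (Suc k) = fib_coeff i (k - 1) - fib_coeff i k"
proof -
  obtain d where d: "k = i + Suc d" using assms less_iff_Suc_add by auto
  show ?thesis by (cases d) (auto simp: fib_coeff_def d eval_nat_numeral algebra_simps)
qed

text \<open>
  The Fibonacci recurrence, read as the inversion formula that recovers \<open>x\<close> from its transform.
  The truncated \<open>k - 1\<close> is harmless at \<open>k = 0\<close>: there it yields \<open>fib_conv x 0 = 0\<close>, which is the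
  right value for the term with index \<open>- 1\<close>.
\<close>

lemma fib_conv_Suc: "fib_conv x (Suc k) = x k - fib_conv x k + fib_conv x (k - 1)"
proof -
  have "fib_conv x (Suc k) = x k + (\<Sum>i<k. fib_coeff i (Suc k) * x i)"
    by (simp add: fib_conv_def fib_coeff_def)
  also have "(\<Sum>i<k. fib_coeff i (Suc k) * x i)
      = (\<Sum>i<k. fib_coeff i (k - 1) * x i) - (\<Sum>i<k. fib_coeff i k * x i)"
    unfolding sum_subtractf[symmetric]
    by (intro sum.cong) (auto simp: fib_coeff_rec left_diff_distrib)
  also have "(\<Sum>i<k. fib_coeff i (k - 1) * x i) = fib_conv x (k - 1)"
    unfolding fib_conv_def
    by (rule sum.mono_neutral_right) (auto simp: fib_coeff_def)
  finally show ?thesis by (simp add: fib_conv_def)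
qed

lemma fib_conv_0 [simp]: "fib_conv x 0 = 0" by (simp add: fib_conv_def)

text \<open>
  The factorization \<open>Z = (I - K) (I - K)\<^sup>T\<close>. The products of identity with \<open>K\<close> give the isolated
  Fibonacci term, and the product of \<open>K\<close> with its transpose gives the sum, which starts after the
  larger of the two indices.
\<close>

lemma Z_entry_factor:
  assumes "i < n" "j < n"
  shows "Z_entry n (Suc i) (Suc j)
    = (\<Sum>k<n. (of_bool (i = k) - fib_coeff i k) * (of_bool (j = k) - fib_coeff j k))"
proof -
  have tail: "(\<Sum>k<n. fib_coeff i k * fib_coeff j k)
      = (- 1) ^ (j - i) * (\<Sum>k = Suc j + 1..n. real (fib (k - Suc i)) * real (fib (k - Suc j)))"
    if "i \<le> j" for i j
  proof -
    have "(\<Sum>k<n. fib_coeff i k * fib_coeff j k) = (\<Sum>k\<in>{Suc j..<n}. fib_coeff i k * fib_coeff j k)"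
      by (rule sum.mono_neutral_right) (auto simp: fib_coeff_def)
    also have "\<dots> = (\<Sum>k\<in>{Suc j..<n}. (- 1) ^ (j - i) * (real (fib (k - i)) * real (fib (k - j))))"
    proof (rule sum.cong[OF refl])
      fix k assume k: "k \<in> {Suc j..<n}"
      have "k - i = (j - i) + (k - j)" using k that by auto
      hence "(- 1 :: real) ^ (k - i) * (- 1) ^ (k - j) = (- 1) ^ (j - i)"
        by (simp add: power_add flip: power_mult_distrib)
      thus "fib_coeff i k * fib_coeff j k
          = (- 1) ^ (j - i) * (real (fib (k - i)) * real (fib (k - j)))"
        using k that by (simp add: fib_coeff_def mult.left_commute mult.assoc)
    qed
    also have "\<dots> = (- 1) ^ (j - i) * (\<Sum>k\<in>{Suc j..<n}. real (fib (k - i)) * real (fib (k - j)))"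
      by (simp add: sum_distrib_left)
    also have "(\<Sum>k\<in>{Suc j..<n}. real (fib (k - i)) * real (fib (k - j)))
        = (\<Sum>k = Suc j + 1..n. real (fib (k - Suc i)) * real (fib (k - Suc j)))"
      by (rule sum.reindex_bij_witness[of _ "\<lambda>k. k - 1" Suc]) auto
    finally show ?thesis .
  qed
  have delta: "(\<Sum>k<n. of_bool (i = k) * f k) = f i" if "i < n" for i and f :: "nat \<Rightarrow> real"
  proof -
    have "(\<Sum>k<n. of_bool (i = k) * f k) = (\<Sum>k\<in>{i}. of_bool (i = k) * f k)"
      by (rule sum.mono_neutral_right) (use that in auto)
    thus ?thesis by simp
  qed
  have expand: "(a - b) * (c - d) = a * c - a * d - c * b + b * d" for a b c d :: real
    by (simp add: algebra_simps)
  have "(\<Sum>k<n. (of_bool (i = k) - fib_coeff i k) * (of_bool (j = k) - fib_coeff j k))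
      = (\<Sum>k<n. of_bool (i = k) * of_bool (j = k)) - (\<Sum>k<n. of_bool (i = k) * fib_coeff j k)
        - (\<Sum>k<n. of_bool (j = k) * fib_coeff i k) + (\<Sum>k<n. fib_coeff i k * fib_coeff j k)"
    unfolding sum_subtractf[symmetric] sum.distrib[symmetric] expand ..
  also have "\<dots> = of_bool (i = j) - fib_coeff j i - fib_coeff i j + (\<Sum>k<n. fib_coeff i k * fib_coeff j k)"
    unfolding delta[OF assms(1)] delta[OF assms(2)] eq_commute[of j i] ..
  also have "\<dots> = Z_entry n (Suc i) (Suc j)"
  proof (cases i j rule: linorder_cases)
    case less
    show ?thesis
      unfolding tail[OF less_imp_le[OF less]] using less
      by (simp add: Z_entry_def fib_coeff_def distrib_left)
  next
    case equal
    show ?thesis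
      unfolding equal tail[of j j, OF order_refl] by (simp add: Z_entry_def fib_coeff_def power2_eq_square)
  next
    case greater
    have "(\<Sum>k<n. fib_coeff i k * fib_coeff j k) = (\<Sum>k<n. fib_coeff j k * fib_coeff i k)"
      by (simp only: mult.commute)
    also note tail[OF less_imp_le[OF greater]]
    also have "(\<Sum>k = Suc i + 1..n. real (fib (k - Suc j)) * real (fib (k - Suc i)))
        = (\<Sum>k = Suc i + 1..n. real (fib (k - Suc i)) * real (fib (k - Suc j)))"
      by (simp only: mult.commute)
    finally show ?thesis using greater
      by (simp add: Z_entry_def fib_coeff_def distrib_left)
  qed
  finally show ?thesis ..
qed

lemma Z_mat_carrier: "Z_mat n \<in> carrier_mat n n"
  by (simp add: Z_mat_def)

lemma transpose_Z_mat: "transpose_mat (Z_mat n) = Z_mat n"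
  by (rule eq_matI) (auto simp: Z_mat_def Z_entry_factor mult.commute)

lemma Z_mat_form:
  assumes "x \<in> carrier_vec n"
  shows "x \<bullet> (Z_mat n *\<^sub>v x) = (\<Sum>k<n. (x $ k - fib_conv (($) x) k)\<^sup>2)"
proof -
  define m where "m i k = of_bool (i = k) - fib_coeff i k" for i k
  have "x \<bullet> (Z_mat n *\<^sub>v x) = (\<Sum>i<n. x $ i * (\<Sum>j<n. (\<Sum>k<n. m i k * m j k) * x $ j))"
    using assms by (auto simp: scalar_prod_def Z_mat_def atLeast0LessThan Z_entry_factor m_def intro!: sum.cong)
  also have "\<dots> = (\<Sum>i<n. \<Sum>j<n. \<Sum>k<n. (m i k * x $ i) * (m j k * x $ j))"
    by (simp add: sum_distrib_left sum_distrib_right mult_ac)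
  also have "\<dots> = (\<Sum>i<n. \<Sum>k<n. \<Sum>j<n. (m i k * x $ i) * (m j k * x $ j))"
    by (intro sum.cong refl sum.swap)
  also have "\<dots> = (\<Sum>k<n. \<Sum>i<n. \<Sum>j<n. (m i k * x $ i) * (m j k * x $ j))"
    by (rule sum.swap)
  also have "\<dots> = (\<Sum>k<n. (\<Sum>i<n. m i k * x $ i)\<^sup>2)"
    by (simp add: power2_eq_square sum_product)
  also have "\<dots> = (\<Sum>k<n. (x $ k - fib_conv (($) x) k)\<^sup>2)"
  proof (rule sum.cong[OF refl])
    fix k assume k: "k \<in> {..<n}"
    have "(\<Sum>i<n. m i k * x $ i) = (\<Sum>i<n. of_bool (i = k) * x $ i) - (\<Sum>i<n. fib_coeff i k * x $ i)"
      by (simp add: m_def left_diff_distrib sum_subtractf)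
    also have "(\<Sum>i<n. of_bool (i = k) * x $ i) = x $ k"
      using k by (simp add: of_bool_def if_distrib if_distribR cong: if_cong)
    also have "(\<Sum>i<n. fib_coeff i k * x $ i) = fib_conv (($) x) k"
      unfolding fib_conv_def using k by (intro sum.mono_neutral_right) (auto simp: fib_coeff_def)
    finally show "(\<Sum>i<n. m i k * x $ i)\<^sup>2 = (x $ k - fib_conv (($) x) k)\<^sup>2" by simp
  qed
  finally show ?thesis .
qed

text \<open>
  Writing \<open>p\<close>, \<open>q\<close>, \<open>r\<close> for three consecutive values of the transform, from later to earlier, the
  \<open>k\<close>-th term on the left is \<open>4/5 (p + q - r)\<^sup>2 - (p - r)\<^sup>2\<close>. It differs from \<open>1/5 (p + r)\<^sup>2\<close> by
  \<open>- 2/5 (p\<^sup>2 - q\<^sup>2) + 2/5 (q\<^sup>2 - r\<^sup>2) + 8/5 (p q - q r)\<close>, which telescopes.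
\<close>

lemma fib_conv_square_identity:
  "4 / 5 * (\<Sum>k<n. (x k)\<^sup>2) - (\<Sum>k<n. (x k - fib_conv x k)\<^sup>2)
    = 1 / 5 * (\<Sum>k<n. (fib_conv x (Suc k) + fib_conv x (k - 1))\<^sup>2)
      - 2 / 5 * (fib_conv x n)\<^sup>2 + 2 / 5 * (fib_conv x (n - 1))\<^sup>2
      + 8 / 5 * fib_conv x n * fib_conv x (n - 1)"
proof (induction n)
  case (Suc n)
  have x: "x n = fib_conv x (Suc n) + fib_conv x n - fib_conv x (n - 1)"
    by (simp add: fib_conv_Suc)
  have "4 / 5 * (x n)\<^sup>2 - (x n - fib_conv x n)\<^sup>2
      = 1 / 5 * (fib_conv x (Suc n) + fib_conv x (n - 1))\<^sup>2
        - 2 / 5 * (fib_conv x (Suc n))\<^sup>2 + 2 / 5 * (fib_conv x n)\<^sup>2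
        + 8 / 5 * fib_conv x (Suc n) * fib_conv x n
        + 2 / 5 * (fib_conv x n)\<^sup>2 - 2 / 5 * (fib_conv x (n - 1))\<^sup>2
        - 8 / 5 * fib_conv x n * fib_conv x (n - 1)"
    unfolding x by (simp add: power2_eq_square algebra_simps)
  thus ?case using Suc by (simp add: distrib_left)
qed simp

text \<open>
  The equality cases: \<open>\<sigma> = 1\<close> says that the quadratic form vanishes, \<open>\<sigma> = - 1\<close> that the main sum of
  the square identity vanishes. Each step by two multiplies the transform by \<open>\<sigma>\<close>, so it stays at its
  initial value zero.
\<close>

lemma zero_if_fib_conv_two_step:
  fixes \<sigma> :: real
  assumes "\<And>k. k < n \<Longrightarrow> fib_conv x (Suc k) = \<sigma> * fib_conv x (k - 1)" and "k < n"
  shows "x k = 0"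
proof -
  have u: "fib_conv x k = 0" if "k \<le> n" for k
    using that
  proof (induction k rule: less_induct)
    case (less k)
    show ?case
    proof (cases k)
      case (Suc l)
      have "fib_conv x (l - 1) = 0" using less Suc by auto
      thus ?thesis using assms(1)[of l] less.prems Suc by simp
    qed simp
  qed
  have "x k = fib_conv x (Suc k) + fib_conv x k - fib_conv x (k - 1)"
    by (simp add: fib_conv_Suc)
  thus ?thesis using u \<open>k < n\<close> by simp
qed

lemma Z_mat_form_pos:
  assumes x: "x \<in> carrier_vec n" "x \<noteq> 0\<^sub>v n"
  shows "x \<bullet> (Z_mat n *\<^sub>v x) > 0"
proof (rule ccontr)
  assume "\<not> ?thesis"
  hence "(\<Sum>k<n. (x $ k - fib_conv (($) x) k)\<^sup>2) = 0"
    unfolding Z_mat_form[OF x(1)] by (meson linorder_not_less order_antisym sum_nonneg zero_le_power2)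
  hence "x $ k = fib_conv (($) x) k" if "k < n" for k
    using that by (simp add: sum_nonneg_eq_0_iff)
  hence "fib_conv (($) x) (Suc k) = 1 * fib_conv (($) x) (k - 1)" if "k < n" for k
    using that fib_conv_Suc[of "($) x" k] by simp
  from zero_if_fib_conv_two_step[OF this] have "x = 0\<^sub>v n"
    using x(1) by (intro eq_vecI) auto
  thus False using x(2) by simp
qed

text \<open>On the hyperplane, the boundary form of the square identity reduces to a multiple of a square.\<close>

lemma Z_mat_form_less:
  assumes x: "x \<in> carrier_vec n" "x \<noteq> 0\<^sub>v n" and u: "fib_conv (($) x) n = 0"
  shows "x \<bullet> (Z_mat n *\<^sub>v x) < 4 / 5 * (x \<bullet> x)"
proof (rule ccontr)
  assume ge: "\<not> ?thesis"
  let ?u = "fib_conv (($) x)"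
  have "x \<bullet> x = (\<Sum>k<n. (x $ k)\<^sup>2)"
    using x by (simp add: scalar_prod_def atLeast0LessThan power2_eq_square)
  with ge have "4 / 5 * (\<Sum>k<n. (x $ k)\<^sup>2) - (\<Sum>k<n. (x $ k - ?u k)\<^sup>2) \<le> 0"
    by (simp add: Z_mat_form[OF x(1)])
  hence "(\<Sum>k<n. (?u (Suc k) + ?u (k - 1))\<^sup>2) + 2 * (?u (n - 1))\<^sup>2 \<le> 0"
    unfolding fib_conv_square_identity u by simp
  moreover have nonneg: "(\<Sum>k<n. (?u (Suc k) + ?u (k - 1))\<^sup>2) \<ge> 0" by (intro sum_nonneg) auto
  ultimately have "(\<Sum>k<n. (?u (Suc k) + ?u (k - 1))\<^sup>2) = 0"
    by (smt (verit) zero_le_power2)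
  hence "?u (Suc k) = - 1 * ?u (k - 1)" if "k < n" for k
    using that by (simp add: sum_nonneg_eq_0_iff eq_neg_iff_add_eq_0)
  from zero_if_fib_conv_two_step[OF this] have "x = 0\<^sub>v n"
    using x(1) by (intro eq_vecI) auto
  thus False using x(2) by simp
qed

lemma Z_mat_trace_gt:
  assumes "n \<ge> 2"
  shows "(\<Sum>i<n. Z_mat n $$ (i, i)) > real n"
proof -
  have ge: "Z_mat n $$ (i, i) \<ge> 1" if "i < n" for i
    using that by (simp add: Z_mat_def Z_entry_def sum_nonneg)
  have "Z_mat n $$ (0, 0) = 1 + (\<Sum>k = 2..n. (real (fib (k - 1)))\<^sup>2)"
    using assms by (simp add: Z_mat_def Z_entry_def numeral_2_eq_2)
  moreover have "(\<Sum>k = 2..n. (real (fib (k - 1)))\<^sup>2) > 0"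
    using assms by (intro sum_pos2[of _ 2]) auto
  ultimately have "Z_mat n $$ (0, 0) > 1" by simp
  hence "(\<Sum>i<n. 1) < (\<Sum>i<n. Z_mat n $$ (i, i))"
    using assms ge by (intro sum_strict_mono_ex1) auto
  thus ?thesis by simp
qed

section \<open>The eigenvalue bounds\<close>

theorem lemma2p3:
  fixes n :: nat
  assumes "n \<ge> 2"
  shows "length (eigenvalues_desc (Z_mat n)) = n
    \<and> (\<forall>k < n. eigenvalues_desc (Z_mat n) ! k > 0)
    \<and> eigenvalues_desc (Z_mat n) ! 1 < 4 / 5
    \<and> eigenvalues_desc (Z_mat n) ! 0 > 1"
proof (intro conjI allI impI)
  let ?es = "eigenvalues_desc (Z_mat n)"
  note Z = Z_mat_carrier[of n] and sym = transpose_Z_mat[of n]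
  note E = symmetric_eigenvalues_desc[OF Z sym]
  show len: "length ?es = n" by (rule E(1))
  show "?es ! k > 0" if "k < n" for k
  proof -
    have "poly (char_poly (Z_mat n)) (?es ! k) = 0"
      unfolding E(2) using linear_poly_root[of "?es ! k" ?es] that len by simp
    then obtain v where v: "v \<in> carrier_vec n" "v \<noteq> 0\<^sub>v n" "Z_mat n *\<^sub>v v = ?es ! k \<cdot>\<^sub>v v"
      using eigenvalue_root_char_poly[OF Z] Z unfolding eigenvalue_def eigenvector_def by auto
    have "v \<bullet> v > 0" using conjugate_square_greater_0_vec[OF v(1)] v(2) by auto
    moreover have "?es ! k * (v \<bullet> v) > 0"
      using Z_mat_form_pos[OF v(1,2)] v by simp
    ultimately show ?thesis by (simp add: zero_less_mult_iff)
  qed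
  show "?es ! 1 < 4 / 5"
  proof (rule second_eigenvalue_less[OF Z sym assms])
    fix x assume x: "x \<in> carrier_vec n" "x \<noteq> 0\<^sub>v n"
      and c: "vec n (\<lambda>i. fib_coeff i n) \<bullet> x = 0"
    have "fib_conv (($) x) n = 0"
      using c x by (simp add: scalar_prod_def fib_conv_def atLeast0LessThan)
    thus "x \<bullet> (Z_mat n *\<^sub>v x) < 4 / 5 * (x \<bullet> x)" by (rule Z_mat_form_less[OF x])
  qed simp
  show "?es ! 0 > 1"
  proof (rule ccontr)
    assume "\<not> ?es ! 0 > 1"
    moreover have "?es ! k \<le> ?es ! 0" if "k < n" for k
      using sorted_rev_nth_mono[OF E(3), of 0 k] that len by simp
    ultimately have "?es ! k \<le> 1" if "k < n" for k using that by fastforce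
    hence "sum_list ?es \<le> (\<Sum>k<n. 1)"
      unfolding sum_list_sum_nth len atLeast0LessThan by (intro sum_mono) auto
    thus False
      using Z_mat_trace_gt[OF assms] trace_eq_sum_list_eigenvalues[OF Z E(2)] by simp
  qed
qed

end
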